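(* (Comparison Principle.) If $V_1\in\mathcal{W}$ (resp. $V_2\in\mathcal{W}$) is a viscosity supersolution (resp. viscosity subsolution) of the equation $$q u(x)-\sup_{0\le l\le F(x)}\mathcal{L}_l[u](x)=0,\qquad x>0,$$ and if one of the following conditions is satisfied: \begin{enumerate} \item $V_1(0)\ge V_2(0)$; \item $V_1'(0+)\le V_2'(0+)$, assuming both (right) derivatives exist, \end{enumerate} then $V_1\ge V_2$ on $[0,\infty)$.
   Context: Fix $\mu\in\mathbb{R}$, $\sigma>0$, $q>0$ and a nondecreasing, concave, continuously differentiable function $F:\mathbb{R}_+\to\mathbb{R}_+$ (so $F(0)\ge0$). For a $C^2$ function $u$ and a constant $l\ge0$, $\mathcal{L}_l[u](x)=(\mu-l)u'(x)+\tfrac12\sigma^2u''(x)+l$. $\mathcal{W}$ is the set of continuous functions $u:[0,\infty)\to\mathbb{R}$ with $\sup_{x\ge0}\frac{|u(x)|}{1+x}<\infty$. A continuous function $u$ is a viscosity supersolution (resp. subsolution) of the equation $q u(x)-\sup_{0\le l\le F(x)}\mathcal{L}_l[u](x)=0$, $x>0$, if for all $x\in(0,\infty)$ and all $\phi\in C^2[0,\infty)$ with $\phi(x)=u(x)$ and $u\ge\phi$ (resp. $u\le\phi$), one has $q\phi(x)-\sup_{0\le l\le F(x)}\mathcal{L}_l[\phi](x)\ge0$ (resp. $\le0$). *)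

theory Defs
  imports "HOL-Analysis.Analysis"
begin

(* Functions on the closed half-line are total real functions of which only the values on {0..}
   matter.  Derivatives below are therefore taken within {0..}: they are one-sided at 0 and
   ordinary derivatives at every x > 0. *)

definition C1_halfline :: "(real \<Rightarrow> real) \<Rightarrow> bool" where
  "C1_halfline f \<longleftrightarrow>
     (\<exists>f'. (\<forall>x\<ge>0. (f has_real_derivative f' x) (at x within {0..})) \<and> continuous_on {0..} f')"

definition C2_halfline :: "(real \<Rightarrow> real) \<Rightarrow> bool" where
  "C2_halfline f \<longleftrightarrow>
     (\<exists>f'. (\<forall>x\<ge>0. (f has_real_derivative f' x) (at x within {0..})) \<and> C1_halfline f')"

definition linear_growth_space :: "(real \<Rightarrow> real) set" where
  "linear_growth_space =
     {u. continuous_on {0..} u \<and> bdd_above ((\<lambda>x. \<bar>u x\<bar> / (1 + x)) ` {0..})}"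

definition generator :: "real \<Rightarrow> real \<Rightarrow> real \<Rightarrow> (real \<Rightarrow> real) \<Rightarrow> real \<Rightarrow> real" where
  "generator \<mu> \<sigma> l u x = (\<mu> - l) * deriv u x + 1/2 * \<sigma>\<^sup>2 * deriv (deriv u) x + l"

(* The supremum runs over a nonempty compact interval when F x \<ge> 0.  For a C2_halfline function
   the two-sided derivatives in the generator exist at every x > 0, the only points where the
   operator is evaluated. *)
definition hjb_operator ::
  "real \<Rightarrow> real \<Rightarrow> real \<Rightarrow> (real \<Rightarrow> real) \<Rightarrow> (real \<Rightarrow> real) \<Rightarrow> real \<Rightarrow> real" where
  "hjb_operator \<mu> \<sigma> q F u x = q * u x - (SUP l\<in>{0..F x}. generator \<mu> \<sigma> l u x)"

definition viscosity_supersolution ::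
  "real \<Rightarrow> real \<Rightarrow> real \<Rightarrow> (real \<Rightarrow> real) \<Rightarrow> (real \<Rightarrow> real) \<Rightarrow> bool" where
  "viscosity_supersolution \<mu> \<sigma> q F u \<longleftrightarrow>
     continuous_on {0..} u \<and>
     (\<forall>x>0. \<forall>\<phi>. C2_halfline \<phi> \<and> \<phi> x = u x \<and> (\<forall>y\<ge>0. u y \<ge> \<phi> y) \<longrightarrow>
        hjb_operator \<mu> \<sigma> q F \<phi> x \<ge> 0)"

definition viscosity_subsolution ::
  "real \<Rightarrow> real \<Rightarrow> real \<Rightarrow> (real \<Rightarrow> real) \<Rightarrow> (real \<Rightarrow> real) \<Rightarrow> bool" where
  "viscosity_subsolution \<mu> \<sigma> q F u \<longleftrightarrow>
     continuous_on {0..} u \<and>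
     (\<forall>x>0. \<forall>\<phi>. C2_halfline \<phi> \<and> \<phi> x = u x \<and> (\<forall>y\<ge>0. u y \<le> \<phi> y) \<longrightarrow>
        hjb_operator \<mu> \<sigma> q F \<phi> x \<le> 0)"

end

theory Submission imports Defs begin

text \<open>
  Maximising over the control gives
  \<open>(SUP l\<in>{0..F x}. (\<mu> - l) * p + l) = \<mu> * p + F x * max 0 (1 - p)\<close>, and since \<open>\<sigma> > 0\<close> the equation can
  be solved for the second derivative: \<open>u'' = G(x, u, u')\<close>, where \<open>G\<close> (\<open>hjb_rhs\<close> below) is strictly
  increasing in \<open>u\<close> because \<open>q > 0\<close>, and Lipschitz in \<open>(u, u')\<close> locally uniformly in \<open>x\<close>.

  The idea is to compare each viscosity function only with classical solutions.
  On a short interval the Lipschitz bound makes the Dirichlet problem solvable for every choice of boundary values (\<open>dirichlet_problem_solvable\<close>). Testing with the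
  classical solution itself shows that a subsolution lies below, and a supersolution above, the
  classical solution with the same boundary values (\<open>subsolution_le_classical\<close>,
  \<open>classical_le_supersolution\<close>). Hence, near an interior maximum of a penalised difference of
  \<open>V\<^sub>2\<close> and \<open>V\<^sub>1\<close>, both functions may be replaced by classical solutions \<open>h\<^sub>2\<close> and \<open>h\<^sub>1\<close>: the boundary
  values do not change and the value at the maximum does not decrease. There remains the ordinary
  maximum principle for \<open>C\<^sup>2\<close> functions (\<open>no_interior_penalised_max\<close>).

  The penalty is \<open>\<epsilon> * \<psi> x\<close> with \<open>\<psi> x = C + x\<^sup>2 - x\<close>. It grows faster than linearly, so a maximum exists
  (\<open>penalised_max_exists\<close>). At an interior maximum \<open>h\<^sub>2' = h\<^sub>1' + \<epsilon> * \<psi>'\<close>, and the control term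
  \<open>F x * max 0 (1 - h\<^sub>2' x)\<close> exceeds that of \<open>h\<^sub>1\<close> by at most \<open>F x * \<epsilon> * max 0 (- \<psi>' x)\<close>. Where
  \<open>\<psi>\<close> increases this vanishes, so the growth of \<open>F\<close> does no harm; \<open>\<psi>\<close> decreases only on \<open>{0..<1/2}\<close>, where \<open>F\<close> is bounded by \<open>F 1\<close>, and a large \<open>C\<close> absorbs the rest.
  Finally \<open>\<psi>' 0 = -1\<close>: if \<open>V\<^sub>1'(0+) \<le> V\<^sub>2'(0+)\<close>, the penalised difference strictly increases at \<open>0\<close>, so
  its maximum is not at \<open>0\<close>; if \<open>V\<^sub>1 0 \<ge> V\<^sub>2 0\<close>, its value at \<open>0\<close> is negative. One penalty thus serves
  both boundary conditions.
\<close>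

section \<open>Calculus of functions on the line\<close>

lemma antiderivative_exists:
  fixes f :: "real \<Rightarrow> real"
  assumes "continuous_on UNIV f"
  shows "\<exists>F. \<forall>x. (F has_real_derivative f x) (at x)"
  using einterval_antiderivative[of "-\<infinity>" "\<infinity>" f] assms
  by (auto simp: continuous_on_eq_continuous_at has_real_derivative_iff_has_vector_derivative)

lemma second_derivative_nonpos_at_max:
  fixes g g' :: "real \<Rightarrow> real"
  assumes "a < y" "y < b"
    and max: "\<And>x. a \<le> x \<Longrightarrow> x \<le> b \<Longrightarrow> g x \<le> g y"
    and g: "\<And>x. (g has_real_derivative g' x) (at x)"
    and g': "(g' has_real_derivative d) (at y)"
  shows "g' y = 0" and "d \<le> 0"
proof -
  have "\<forall>x. \<bar>y - x\<bar> < min (y - a) (b - y) \<longrightarrow> g x \<le> g y"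
    using max by auto
  then show 0: "g' y = 0"
    using DERIV_local_max[OF g, of "min (y - a) (b - y)"] assms(1,2) by simp
  show "d \<le> 0"
  proof (rule ccontr)
    assume "\<not> d \<le> 0"
    then obtain e where e: "e > 0" "\<And>h. h > 0 \<Longrightarrow> h < e \<Longrightarrow> g' y < g' (y + h)"
      using has_real_derivative_pos_inc_right[OF g'] by auto
    define z where "z = y + min e (b - y) / 2"
    have z: "y < z" "z < y + e" "z \<le> b"
      using e(1) assms(2) by (auto simp: z_def min_def field_simps)
    obtain t where t: "y < t" "t < z" "g z - g y = (z - y) * g' t"
      using MVT2[of y z g g'] g z(1) by blast
    have "g' t > 0"
      using e(2)[of "t - y"] t z 0 by simp
    then have "g z > g y"
      using t(3) z(1) mult_pos_pos[of "z - y" "g' t"] by linarith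
    then show False
      using max[of z] z assms(1) by simp
  qed
qed

text \<open>
  The Dirichlet problem for \<open>u'' = f\<close>: two antiderivatives, corrected by an affine function to meet
  the boundary values.
\<close>
lemma dirichlet_second_antiderivative:
  fixes f :: "real \<Rightarrow> real"
  assumes "continuous_on UNIV f" "a < b"
  shows "\<exists>u u'. (\<forall>x. (u has_real_derivative u' x) (at x)) \<and>
                (\<forall>x. (u' has_real_derivative f x) (at x)) \<and> u a = \<alpha> \<and> u b = \<beta>"
proof -
  obtain p where p: "\<And>x. (p has_real_derivative f x) (at x)"
    using antiderivative_exists[OF assms(1)] by blast
  then have "continuous_on UNIV p"
    by (meson DERIV_isCont continuous_at_imp_continuous_on)
  then obtain P where P: "\<And>x. (P has_real_derivative p x) (at x)"
    using antiderivative_exists by blast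
  define s where "s = (\<beta> - P b - \<alpha> + P a) / (b - a)"
  have s: "s * (b - a) = \<beta> - P b - \<alpha> + P a"
    using assms(2) by (simp add: s_def)
  have "((\<lambda>x. P x + s * (x - a) + (\<alpha> - P a)) has_real_derivative p x + s) (at x)" for x
    by (auto intro!: derivative_eq_intros P)
  moreover have "((\<lambda>x. p x + s) has_real_derivative f x) (at x)" for x
    by (auto intro!: derivative_eq_intros p)
  ultimately show ?thesis
    using s by (intro exI[of _ "\<lambda>x. P x + s * (x - a) + (\<alpha> - P a)"] exI[of _ "\<lambda>x. p x + s"]) auto
qed

text \<open>
  Since \<open>D\<close> vanishes at both ends, \<open>D'\<close> has a zero inside, and the mean value inequality transports
  the bound on \<open>D''\<close> first to \<open>D'\<close> and then to \<open>D\<close>. This replaces estimates of a Green function and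
  provides the contraction constant for the Dirichlet problem.
\<close>
lemma zero_boundary_bounds:
  fixes D D' D'' :: "real \<Rightarrow> real"
  assumes "a < b" "D a = 0" "D b = 0"
    and D: "\<And>x. (D has_real_derivative D' x) (at x)"
    and D': "\<And>x. (D' has_real_derivative D'' x) (at x)"
    and bd: "\<And>x. \<bar>D'' x\<bar> \<le> B"
    and x: "x \<in> {a..b}"
  shows "\<bar>D' x\<bar> \<le> B * (b - a)" and "\<bar>D x\<bar> \<le> B * (b - a) * (b - a)"
proof -
  obtain c where c: "a < c" "c < b" "D b - D a = (b - a) * D' c"
    using MVT2[of a b D D'] D assms(1) by blast
  then have c0: "D' c = 0"
    using assms(1-3) by simp
  have B0: "B \<ge> 0"
    using bd[of 0] by linarith
  have D'_bd: "\<bar>D' t\<bar> \<le> B * (b - a)" if t: "t \<in> {a..b}" for t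
  proof -
    have "norm (D' t - D' c) \<le> B * norm (t - c)"
      using field_differentiable_bound[of UNIV D' D'' B t c] D' bd by auto
    also have "\<dots> \<le> B * (b - a)"
      using t c B0 by (intro mult_left_mono) auto
    finally show ?thesis
      using c0 by simp
  qed
  show "\<bar>D' x\<bar> \<le> B * (b - a)"
    using D'_bd x by blast
  have "norm (D x - D a) \<le> (B * (b - a)) * norm (x - a)"
    using field_differentiable_bound[of "{a..b}" D D' "B * (b - a)" x a] D D'_bd x assms(1)
    by (auto intro: has_field_derivative_at_within)
  also have "\<dots> \<le> (B * (b - a)) * (b - a)"
    using x B0 assms(1) by (intro mult_left_mono) auto
  finally show "\<bar>D x\<bar> \<le> B * (b - a) * (b - a)"
    using assms(2) by simp
qed

text \<open>
  A locally chosen \<open>C\<^sup>2\<close> function must serve as a test function on the whole half-line; this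
  growth bound is what allows a quartic correction to dominate it far away.
\<close>
lemma quadratic_growth_of_bounded_second_derivative:
  fixes h h' h'' :: "real \<Rightarrow> real"
  assumes h: "\<And>x. (h has_real_derivative h' x) (at x)"
    and h': "\<And>x. (h' has_real_derivative h'' x) (at x)"
    and bd: "\<And>x. \<bar>h'' x\<bar> \<le> B"
  shows "\<exists>C\<ge>0. \<forall>x\<ge>0. \<bar>h x\<bar> \<le> C * (1 + x)\<^sup>2"
proof -
  have B0: "B \<ge> 0"
    using bd[of 0] by linarith
  have h'_bd: "\<bar>h' x\<bar> \<le> \<bar>h' 0\<bar> + B * \<bar>x\<bar>" for x
    using field_differentiable_bound[of UNIV h' h'' B x 0] h' bd by auto
  define C where "C = \<bar>h 0\<bar> + \<bar>h' 0\<bar> + B"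
  have "\<bar>h x\<bar> \<le> C * (1 + x)\<^sup>2" if x: "x \<ge> 0" for x
  proof -
    have "norm (h x - h 0) \<le> (\<bar>h' 0\<bar> + B * x) * norm (x - 0)"
    proof (rule field_differentiable_bound[of "{0..x}" h h'])
      fix z assume z: "z \<in> {0..x}"
      show "(h has_field_derivative h' z) (at z within {0..x})"
        using h by (rule has_field_derivative_at_within)
      have "B * \<bar>z\<bar> \<le> B * x"
        using z B0 by (intro mult_left_mono) auto
      then show "norm (h' z) \<le> \<bar>h' 0\<bar> + B * x"
        using h'_bd[of z] by simp
    qed (use x in auto)
    then have "\<bar>h x\<bar> \<le> \<bar>h 0\<bar> + \<bar>h' 0\<bar> * x + B * x\<^sup>2"
      using x by (simp add: power2_eq_square algebra_simps)
    also have "\<dots> \<le> \<bar>h 0\<bar> * (1 + x)\<^sup>2 + \<bar>h' 0\<bar> * (1 + x)\<^sup>2 + B * (1 + x)\<^sup>2"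
    proof (intro add_mono mult_left_mono)
      show "\<bar>h 0\<bar> \<le> \<bar>h 0\<bar> * (1 + x)\<^sup>2"
        using x by (intro mult_le_cancel_left1[THEN iffD2]) (auto simp: one_le_power)
      show "x \<le> (1 + x)\<^sup>2" "x\<^sup>2 \<le> (1 + x)\<^sup>2"
        using x by (auto simp: power2_eq_square algebra_simps)
    qed (use B0 in auto)
    finally show ?thesis
      by (simp add: C_def algebra_simps)
  qed
  then show ?thesis
    using B0 by (intro exI[of _ C]) (auto simp: C_def)
qed

section \<open>The Dirichlet problem on short intervals\<close>

text \<open>
  The unknown of the fixed point equation is the second derivative \<open>f\<close>: from \<open>f\<close> one recovers the
  function with the prescribed boundary values and inserts it into \<open>G\<close>. By
  \<open>zero_boundary_bounds\<close> this is a contraction in the supremum norm once the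
  interval is short enough. Working with \<open>f\<close> rather than \<open>h\<close> also yields the global
  boundedness and continuity of \<open>h''\<close> that the construction of test functions needs.
\<close>
lemma dirichlet_problem_solvable:
  fixes G :: "real \<Rightarrow> real \<Rightarrow> real \<Rightarrow> real"
  assumes ab: "a < b" and L: "L \<ge> 0"
    and contG: "\<And>u p. continuous_on {a..b} u \<Longrightarrow> continuous_on {a..b} p \<Longrightarrow>
                  continuous_on {a..b} (\<lambda>x. G x (u x) (p x))"
    and lip: "\<And>x u p v r. x \<in> {a..b} \<Longrightarrow> \<bar>G x u p - G x v r\<bar> \<le> L * (\<bar>u - v\<bar> + \<bar>p - r\<bar>)"
    and short: "L * ((b - a) * (b - a) + (b - a)) < 1"
  shows "\<exists>h h' h''. (\<forall>x. (h has_real_derivative h' x) (at x)) \<and>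
           (\<forall>x. (h' has_real_derivative h'' x) (at x)) \<and> continuous_on UNIV h'' \<and>
           (\<exists>B. \<forall>x. \<bar>h'' x\<bar> \<le> B) \<and> h a = \<alpha> \<and> h b = \<beta> \<and>
           (\<forall>x\<in>{a..b}. h'' x = G x (h x) (h' x))"
proof -
  have "\<forall>f :: real \<Rightarrow>\<^sub>C real. \<exists>u u'. (\<forall>x. (u has_real_derivative u' x) (at x)) \<and>
          (\<forall>x. (u' has_real_derivative f x) (at x)) \<and> u a = \<alpha> \<and> u b = \<beta>"
    using dirichlet_second_antiderivative ab by simp
  then obtain U U' :: "(real \<Rightarrow>\<^sub>C real) \<Rightarrow> real \<Rightarrow> real"
    where U: "\<And>f x. (U f has_real_derivative U' f x) (at x)"
    and U': "\<And>f x. (U' f has_real_derivative f x) (at x)"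
    and bdry: "\<And>f. U f a = \<alpha>" "\<And>f. U f b = \<beta>"
    by metis
  \<comment> \<open>Freezing the nonlinearity outside the interval keeps it bounded and continuous on the whole
    line, so that the fixed point lives in a complete space of functions.\<close>
  define c where "c x = max a (min b x)" for x
  have c: "c x \<in> {a..b}" for x
    using ab by (auto simp: c_def)
  have c_id: "x \<in> {a..b} \<Longrightarrow> c x = x" for x
    by (auto simp: c_def)
  have c_cont: "continuous_on UNIV c"
    unfolding c_def by (intro continuous_intros)
  define N where "N f x = G (c x) (U f (c x)) (U' f (c x))" for f x
  have N: "N f \<in> bcontfun" for f
  proof -
    have "continuous_on {a..b} (U f)" "continuous_on {a..b} (U' f)"
      using U U' by (meson DERIV_isCont continuous_at_imp_continuous_on)+
    then have G: "continuous_on {a..b} (\<lambda>x. G x (U f x) (U' f x))"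
      by (rule contG)
    have "continuous_on UNIV (\<lambda>x. G (c x) (U f (c x)) (U' f (c x)))"
      by (rule continuous_on_compose2[OF G c_cont]) (use c in blast)
    moreover have "bounded ((\<lambda>x. G x (U f x) (U' f x)) ` {a..b})"
      using G compact_Icc compact_continuous_image compact_imp_bounded by blast
    then have "bounded (range (N f))"
      by (rule bounded_subset) (use c in \<open>auto simp: N_def\<close>)
    ultimately show ?thesis
      by (simp add: bcontfun_def N_def[abs_def])
  qed
  define T where "T f = Bcontfun (N f)" for f
  have T: "apply_bcontfun (T f) = N f" for f
    using N by (simp add: T_def Bcontfun_inverse)
  define k where "k = L * ((b - a) * (b - a) + (b - a))"
  have contraction: "dist (T f) (T g) \<le> k * dist f g" for f g
  proof (rule dist_bound)
    fix x
    define D where "D t = U f t - U g t" for t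
    define D' where "D' t = U' f t - U' g t" for t
    have "(D has_real_derivative D' t) (at t)" for t
      unfolding D_def D'_def by (auto intro!: derivative_eq_intros U)
    moreover have "(D' has_real_derivative f t - g t) (at t)" for t
      unfolding D'_def by (auto intro!: derivative_eq_intros U')
    moreover have "\<bar>f t - g t\<bar> \<le> dist f g" for t
      using dist_bounded[of f t g] by (simp add: dist_real_def)
    ultimately have "\<bar>D' (c x)\<bar> \<le> dist f g * (b - a)"
      and "\<bar>D (c x)\<bar> \<le> dist f g * (b - a) * (b - a)"
      using zero_boundary_bounds[of a b D D' "\<lambda>t. f t - g t" "dist f g" "c x"] ab c
      by (auto simp: D_def bdry)
    then have "L * (\<bar>D (c x)\<bar> + \<bar>D' (c x)\<bar>) \<le>
        L * (dist f g * (b - a) * (b - a) + dist f g * (b - a))"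
      using L by (intro mult_left_mono add_mono) auto
    also have "\<dots> = k * dist f g"
      by (simp add: k_def algebra_simps)
    finally show "dist (T f x) (T g x) \<le> k * dist f g"
      using lip[OF c, of x "U f (c x)" "U' f (c x)" "U g (c x)" "U' g (c x)"]
      by (simp add: T N_def dist_real_def D_def D'_def)
  qed
  have "\<exists>!f. T f = f"
    using contraction short L ab by (intro banach_fix_type[of k]) (auto simp: k_def)
  then obtain f where f: "T f = f"
    by blast
  have fix_eq: "f x = G x (U f x) (U' f x)" if "x \<in> {a..b}" for x
    using T[of f] f c_id[OF that] by (simp add: N_def)
  obtain B where B: "\<And>x. \<bar>f x\<bar> \<le> B"
    using norm_bounded[of f] by force
  show ?thesis
    by (rule exI[of _ "U f"], rule exI[of _ "U' f"], rule exI[of _ "apply_bcontfun f"])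
      (use U U' bdry fix_eq B in auto)
qed

section \<open>Viscosity inequalities in terms of local test functions\<close>

text \<open>
  The equation solved for the second derivative: a classical solution satisfies
  \<open>u'' x = hjb_rhs \<mu> \<sigma> q F x (u x) (u' x)\<close>.
\<close>
definition hjb_rhs ::
  "real \<Rightarrow> real \<Rightarrow> real \<Rightarrow> (real \<Rightarrow> real) \<Rightarrow> real \<Rightarrow> real \<Rightarrow> real \<Rightarrow> real" where
  "hjb_rhs \<mu> \<sigma> q F x u p = 2 / \<sigma>\<^sup>2 * (q * u - \<mu> * p - F x * max 0 (1 - p))"

text \<open>
  The expression under the supremum is affine in \<open>l\<close>, so the supremum is attained at an end of the
  interval: at \<open>F x\<close> if \<open>\<phi>' x \<le> 1\<close>, and at \<open>0\<close> otherwise.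
\<close>
lemma hjb_operator_eq:
  fixes \<phi> \<phi>' \<phi>'' :: "real \<Rightarrow> real"
  assumes "\<sigma> > 0" "F x \<ge> 0"
    and d: "\<And>t. (\<phi> has_real_derivative \<phi>' t) (at t)"
    and d': "\<And>t. (\<phi>' has_real_derivative \<phi>'' t) (at t)"
  shows "hjb_operator \<mu> \<sigma> q F \<phi> x = \<sigma>\<^sup>2 / 2 * (hjb_rhs \<mu> \<sigma> q F x (\<phi> x) (\<phi>' x) - \<phi>'' x)"
proof -
  have "deriv \<phi> = \<phi>'" "deriv \<phi>' = \<phi>''"
    using d d' by (auto intro!: ext DERIV_imp_deriv)
  then have gen: "generator \<mu> \<sigma> l \<phi> x = \<mu> * \<phi>' x + \<sigma>\<^sup>2 / 2 * \<phi>'' x + l * (1 - \<phi>' x)" for l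
    by (simp add: generator_def algebra_simps)
  have "(SUP l\<in>{0..F x}. generator \<mu> \<sigma> l \<phi> x) =
      \<mu> * \<phi>' x + \<sigma>\<^sup>2 / 2 * \<phi>'' x + F x * max 0 (1 - \<phi>' x)"
  proof (rule cSup_eq_maximum)
    show "\<mu> * \<phi>' x + \<sigma>\<^sup>2 / 2 * \<phi>'' x + F x * max 0 (1 - \<phi>' x)
        \<in> (\<lambda>l. generator \<mu> \<sigma> l \<phi> x) ` {0..F x}"
      by (rule image_eqI[of _ _ "if \<phi>' x \<le> 1 then F x else 0"])
        (use assms(2) in \<open>auto simp: gen max_def\<close>)
  next
    fix y assume "y \<in> (\<lambda>l. generator \<mu> \<sigma> l \<phi> x) ` {0..F x}"
    then obtain l where l: "0 \<le> l" "l \<le> F x" "y = generator \<mu> \<sigma> l \<phi> x"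
      by auto
    have "l * (1 - \<phi>' x) \<le> l * max 0 (1 - \<phi>' x)"
      using l by (intro mult_left_mono) auto
    also have "\<dots> \<le> F x * max 0 (1 - \<phi>' x)"
      using l by (intro mult_right_mono) auto
    finally show "y \<le> \<mu> * \<phi>' x + \<sigma>\<^sup>2 / 2 * \<phi>'' x + F x * max 0 (1 - \<phi>' x)"
      by (simp add: l gen)
  qed
  then show ?thesis
    unfolding hjb_operator_def hjb_rhs_def using assms(1) by (simp only:) (simp add: field_simps)
qed

lemma C2_halflineI:
  assumes "\<And>x. (f has_real_derivative f' x) (at x)"
    and "\<And>x. (f' has_real_derivative f'' x) (at x)" and "continuous_on UNIV f''"
  shows "C2_halfline f"
  unfolding C2_halfline_def C1_halfline_def
  using assms has_field_derivative_at_within continuous_on_subset by blast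

lemma linear_growth_bound:
  assumes "u \<in> linear_growth_space"
  shows "\<exists>A\<ge>0. \<forall>x\<ge>0. \<bar>u x\<bar> \<le> A * (1 + x)"
proof -
  obtain A where A: "\<And>x. x \<ge> 0 \<Longrightarrow> \<bar>u x\<bar> / (1 + x) \<le> A"
    using assms by (auto simp: linear_growth_space_def bdd_above_def)
  have "\<bar>u x\<bar> \<le> \<bar>A\<bar> * (1 + x)" if "x \<ge> 0" for x
  proof -
    have "\<bar>u x\<bar> \<le> A * (1 + x)"
      using A[OF that] that by (simp add: divide_le_eq)
    also have "\<dots> \<le> \<bar>A\<bar> * (1 + x)"
      using that by (intro mult_right_mono) auto
    finally show ?thesis .
  qed
  then show ?thesis
    by (intro exI[of _ "\<bar>A\<bar>"]) auto
qed

text \<open>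
  In the definition of viscosity solutions a test function has to dominate \<open>u\<close> on the whole half-line,
  whereas classical solutions are compared with \<open>u\<close> only on a short interval. Adding
  \<open>K * (x - y)^4\<close> does not affect the value and the first two derivatives at \<open>y\<close>, and for large \<open>K\<close> it
  outweighs, away from \<open>y\<close>, the at most quadratic growth of \<open>u - h\<close>.
\<close>
lemma global_test_function:
  fixes u h h' h'' :: "real \<Rightarrow> real"
  assumes u: "\<And>x. x \<ge> 0 \<Longrightarrow> \<bar>u x\<bar> \<le> A * (1 + x)" and A: "A \<ge> 0"
    and h: "\<And>x. (h has_real_derivative h' x) (at x)"
    and h': "\<And>x. (h' has_real_derivative h'' x) (at x)"
    and h'': "continuous_on UNIV h''" "\<And>x. \<bar>h'' x\<bar> \<le> B"
    and y: "0 \<le> a" "a < y" "y < b"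
    and max: "\<And>x. x \<in> {a..b} \<Longrightarrow> u x - h x \<le> u y - h y"
  obtains \<phi> \<phi>' \<phi>'' where "\<And>x. (\<phi> has_real_derivative \<phi>' x) (at x)"
    and "\<And>x. (\<phi>' has_real_derivative \<phi>'' x) (at x)" and "C2_halfline \<phi>"
    and "\<phi> y = u y" and "\<phi>' y = h' y" and "\<phi>'' y = h'' y" and "\<forall>x\<ge>0. u x \<le> \<phi> x"
proof -
  obtain C where C: "C \<ge> 0" "\<And>x. x \<ge> 0 \<Longrightarrow> \<bar>h x\<bar> \<le> C * (1 + x)\<^sup>2"
    using quadratic_growth_of_bounded_second_derivative[OF h h' h''(2)] by blast
  define m where "m = u y - h y"
  define E where "E = A + C + \<bar>m\<bar>"
  define \<delta> where "\<delta> = min (y - a) (b - y)"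
  define k where "k = (1 + y) / \<delta> + 1"
  define K where "K = E * k\<^sup>2 / \<delta>\<^sup>2"
  have \<delta>: "\<delta> > 0"
    using y by (simp add: \<delta>_def)
  have E: "E \<ge> 0"
    using A C by (simp add: E_def)
  have K: "K \<ge> 0"
    using E by (simp add: K_def)
  have below: "u x \<le> h x + m + K * (x - y)^4" if x: "x \<ge> 0" for x
  proof (cases "\<bar>x - y\<bar> < \<delta>")
    case True
    then have "x \<in> {a..b}"
      by (auto simp: \<delta>_def)
    from max[OF this] have "u x \<le> h x + m"
      by (simp add: m_def)
    moreover have "K * (x - y)^4 \<ge> 0"
      using K by (intro mult_nonneg_nonneg zero_le_even_power) auto
    ultimately show ?thesis
      by linarith
  next
    case False
    \<comment> \<open>Away from \<open>y\<close> both \<open>1 + x \<le> k * r\<close> and \<open>1 \<le> r\<^sup>2 / \<delta>\<^sup>2\<close>, which turns quadratic growth into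
      a multiple of \<open>r^4\<close>.\<close>
    define r where "r = \<bar>x - y\<bar>"
    have r: "r \<ge> \<delta>"
      using False by (simp add: r_def)
    have "(1 + y) * \<delta> \<le> (1 + y) * r"
      using r y by (intro mult_left_mono) auto
    then have "1 + y \<le> (1 + y) / \<delta> * r"
      using \<delta> by (simp add: field_simps)
    then have kr: "1 + x \<le> k * r"
      by (simp add: k_def distrib_right) (simp add: r_def)
    have x2: "1 + x \<le> (1 + x)\<^sup>2" "1 \<le> (1 + x)\<^sup>2"
      using x by (auto simp: power2_eq_square algebra_simps)
    have "u x - h x - m \<le> A * (1 + x) + C * (1 + x)\<^sup>2 + \<bar>m\<bar> * 1"
      using u[OF x] C(2)[OF x] by simp
    also have "\<dots> \<le> A * (1 + x)\<^sup>2 + C * (1 + x)\<^sup>2 + \<bar>m\<bar> * (1 + x)\<^sup>2"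
      using A C(1) x2 by (intro add_mono mult_left_mono) auto
    also have "\<dots> = E * (1 + x)\<^sup>2"
      by (simp add: E_def algebra_simps)
    also have "\<dots> \<le> E * (k * r)\<^sup>2"
      using kr x E by (intro mult_left_mono power_mono) auto
    also have "\<dots> = E * k\<^sup>2 * r\<^sup>2 * 1"
      by (simp add: power_mult_distrib)
    also have "\<dots> \<le> E * k\<^sup>2 * r\<^sup>2 * (r\<^sup>2 / \<delta>\<^sup>2)"
      using r \<delta> E by (intro mult_left_mono) (auto intro!: power_mono)
    also have "\<dots> = K * r^4"
      by (simp add: K_def power2_eq_square power4_eq_xxxx)
    also have "r^4 = (x - y)^4"
      by (simp add: r_def)
    finally show ?thesis
      by simp
  qed
  let ?\<phi> = "\<lambda>x. h x + m + K * (x - y)^4"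
  let ?\<phi>' = "\<lambda>x. h' x + K * (4 * (x - y)^3)"
  let ?\<phi>'' = "\<lambda>x. h'' x + K * (12 * (x - y)\<^sup>2)"
  have d: "(?\<phi> has_real_derivative ?\<phi>' x) (at x)" for x
    by (auto intro!: derivative_eq_intros h)
  have d': "(?\<phi>' has_real_derivative ?\<phi>'' x) (at x)" for x
    by (auto intro!: derivative_eq_intros h')
  have c: "continuous_on UNIV ?\<phi>''"
    by (intro continuous_intros h''(1))
  have C2: "C2_halfline ?\<phi>"
    by (rule C2_halflineI[of _ ?\<phi>' ?\<phi>'']) (use d d' c in auto)
  show thesis
    by (rule that[of ?\<phi> ?\<phi>' ?\<phi>'']) (use d d' below C2 in \<open>auto simp: m_def\<close>)
qed

lemma subsolution_local_test:
  fixes V h h' h'' :: "real \<Rightarrow> real"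
  assumes V: "viscosity_subsolution \<mu> \<sigma> q F V" "V \<in> linear_growth_space"
    and "\<sigma> > 0" and F: "\<And>x. x \<ge> 0 \<Longrightarrow> F x \<ge> 0"
    and h: "\<And>x. (h has_real_derivative h' x) (at x)"
    and h': "\<And>x. (h' has_real_derivative h'' x) (at x)"
    and h'': "continuous_on UNIV h''" "\<And>x. \<bar>h'' x\<bar> \<le> B"
    and y: "0 \<le> a" "a < y" "y < b"
    and max: "\<And>x. x \<in> {a..b} \<Longrightarrow> V x - h x \<le> V y - h y"
  shows "hjb_rhs \<mu> \<sigma> q F y (V y) (h' y) \<le> h'' y"
proof -
  obtain A where A: "A \<ge> 0" "\<And>x. x \<ge> 0 \<Longrightarrow> \<bar>V x\<bar> \<le> A * (1 + x)"
    using linear_growth_bound[OF V(2)] by blast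
  obtain \<phi> \<phi>' \<phi>'' where \<phi>: "\<And>x. (\<phi> has_real_derivative \<phi>' x) (at x)"
      "\<And>x. (\<phi>' has_real_derivative \<phi>'' x) (at x)" "C2_halfline \<phi>"
      "\<phi> y = V y" "\<phi>' y = h' y" "\<phi>'' y = h'' y" "\<forall>x\<ge>0. V x \<le> \<phi> x"
    by (rule global_test_function[of V A h h' h'' B a y b])
      (use A h h' h'' y max in auto)
  have "hjb_operator \<mu> \<sigma> q F \<phi> y \<le> 0"
    using V(1) \<phi> y by (auto simp: viscosity_subsolution_def)
  moreover have "hjb_operator \<mu> \<sigma> q F \<phi> y = \<sigma>\<^sup>2 / 2 * (hjb_rhs \<mu> \<sigma> q F y (V y) (h' y) - h'' y)"
  proof -
    have "F y \<ge> 0"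
      using F y by simp
    from hjb_operator_eq[where x = y and F = F, OF \<open>\<sigma> > 0\<close> this \<phi>(1,2)]
    show ?thesis
      by (simp only: \<phi>(4-6) minus_minus)
  qed
  moreover have "\<sigma>\<^sup>2 / 2 > 0"
    using \<open>\<sigma> > 0\<close> by simp
  ultimately show ?thesis
    by (simp only: mult_le_0_iff) linarith
qed

text \<open>
  A function touching \<open>V\<close> from below is the negative of one touching \<open>- V\<close> from above, so the
  construction of global test functions is reused for \<open>- V\<close> and \<open>- h\<close>. Only the test function is
  reflected, not the equation, which is not odd.
\<close>
lemma supersolution_local_test:
  fixes V h h' h'' :: "real \<Rightarrow> real"
  assumes V: "viscosity_supersolution \<mu> \<sigma> q F V" "V \<in> linear_growth_space"
    and "\<sigma> > 0" and F: "\<And>x. x \<ge> 0 \<Longrightarrow> F x \<ge> 0"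
    and h: "\<And>x. (h has_real_derivative h' x) (at x)"
    and h': "\<And>x. (h' has_real_derivative h'' x) (at x)"
    and h'': "continuous_on UNIV h''" "\<And>x. \<bar>h'' x\<bar> \<le> B"
    and y: "0 \<le> a" "a < y" "y < b"
    and min: "\<And>x. x \<in> {a..b} \<Longrightarrow> V y - h y \<le> V x - h x"
  shows "h'' y \<le> hjb_rhs \<mu> \<sigma> q F y (V y) (h' y)"
proof -
  obtain A where A: "A \<ge> 0" "\<And>x. x \<ge> 0 \<Longrightarrow> \<bar>- V x\<bar> \<le> A * (1 + x)"
    using linear_growth_bound[OF V(2)] by auto
  have n: "((\<lambda>x. - h x) has_real_derivative - h' x) (at x)"
    "((\<lambda>x. - h' x) has_real_derivative - h'' x) (at x)" for x
    using h h' by (auto intro!: derivative_eq_intros)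
  have n'': "continuous_on UNIV (\<lambda>x. - h'' x)" "\<And>x. \<bar>- h'' x\<bar> \<le> B"
    using h'' by (auto intro!: continuous_intros)
  have n_max: "- V x - - h x \<le> - V y - - h y" if "x \<in> {a..b}" for x
    using min[OF that] by simp
  obtain \<psi> \<psi>' \<psi>'' where \<psi>: "\<And>x. (\<psi> has_real_derivative \<psi>' x) (at x)"
      "\<And>x. (\<psi>' has_real_derivative \<psi>'' x) (at x)" "C2_halfline \<psi>"
      "\<psi> y = - V y" "\<psi>' y = - h' y" "\<psi>'' y = - h'' y" "\<forall>x\<ge>0. - V x \<le> \<psi> x"
    by (rule global_test_function[of "\<lambda>x. - V x" A "\<lambda>x. - h x" "\<lambda>x. - h' x" "\<lambda>x. - h'' x" B a y b])
      (use A n n'' y n_max in auto)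
  have "C1_halfline f \<Longrightarrow> C1_halfline (\<lambda>x. - f x)" for f
    unfolding C1_halfline_def by (metis DERIV_minus continuous_on_minus)
  with \<psi>(3) have C2: "C2_halfline (\<lambda>x. - \<psi> x)"
    unfolding C2_halfline_def by (metis DERIV_minus)
  have d: "((\<lambda>x. - \<psi> x) has_real_derivative - \<psi>' x) (at x)"
    "((\<lambda>x. - \<psi>' x) has_real_derivative - \<psi>'' x) (at x)" for x
    using \<psi> by (auto intro!: derivative_eq_intros)
  have "0 < y"
    using y by simp
  moreover have "- \<psi> y = V y" "\<forall>x\<ge>0. - \<psi> x \<le> V x"
    using \<psi>(4,7) by (auto simp: minus_le_iff)
  ultimately have "hjb_operator \<mu> \<sigma> q F (\<lambda>x. - \<psi> x) y \<ge> 0"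
    using V(1) C2 by (auto simp: viscosity_supersolution_def)
  moreover have "hjb_operator \<mu> \<sigma> q F (\<lambda>x. - \<psi> x) y = \<sigma>\<^sup>2 / 2 * (hjb_rhs \<mu> \<sigma> q F y (V y) (h' y) - h'' y)"
  proof -
    have "F y \<ge> 0"
      using F y by simp
    from hjb_operator_eq[where x = y and F = F, OF \<open>\<sigma> > 0\<close> this d]
    show ?thesis
      by (simp only: \<psi>(4-6) minus_minus)
  qed
  moreover have "\<sigma>\<^sup>2 / 2 > 0"
    using \<open>\<sigma> > 0\<close> by simp
  ultimately show ?thesis
    by (simp only: zero_le_mult_iff) linarith
qed

section \<open>Comparison with classical solutions on an interval\<close>

lemma hjb_rhs_strict_mono:
  assumes "\<sigma> > 0" "q > 0" "u < v"
  shows "hjb_rhs \<mu> \<sigma> q F x u p < hjb_rhs \<mu> \<sigma> q F x v p"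
  unfolding hjb_rhs_def using assms by (intro mult_strict_left_mono) auto

text \<open>
  If \<open>V - h\<close> had a positive maximum, it would be attained inside, because \<open>V = h\<close> at both ends, and
  there \<open>h\<close>, raised by a constant, would touch \<open>V\<close> from above. The subsolution inequality then contradicts the equation
  for \<open>h\<close>, because \<open>hjb_rhs\<close> is strictly larger at the larger value \<open>V y\<close>.
\<close>
lemma subsolution_le_classical:
  fixes V h h' h'' :: "real \<Rightarrow> real"
  assumes V: "viscosity_subsolution \<mu> \<sigma> q F V" "V \<in> linear_growth_space"
    and "\<sigma> > 0" "q > 0" and F: "\<And>x. x \<ge> 0 \<Longrightarrow> F x \<ge> 0"
    and h: "\<And>x. (h has_real_derivative h' x) (at x)"
    and h': "\<And>x. (h' has_real_derivative h'' x) (at x)"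
    and h'': "continuous_on UNIV h''" "\<And>x. \<bar>h'' x\<bar> \<le> B"
    and ab: "0 \<le> a" "a < b" and bdry: "h a = V a" "h b = V b"
    and eq: "\<And>x. x \<in> {a..b} \<Longrightarrow> h'' x = hjb_rhs \<mu> \<sigma> q F x (h x) (h' x)"
    and x: "x \<in> {a..b}"
  shows "V x \<le> h x"
proof (rule ccontr)
  assume neg: "\<not> V x \<le> h x"
  have "continuous_on {0..} V"
    using V(1) by (simp add: viscosity_subsolution_def)
  then have "continuous_on {a..b} V"
    using ab by (auto intro: continuous_on_subset)
  moreover have "continuous_on {a..b} h"
    using h by (meson DERIV_isCont continuous_at_imp_continuous_on)
  ultimately have "continuous_on {a..b} (\<lambda>x. V x - h x)"
    by (rule continuous_on_diff)
  then obtain y where y: "y \<in> {a..b}" "\<And>x. x \<in> {a..b} \<Longrightarrow> V x - h x \<le> V y - h y"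
    using continuous_attains_sup[of "{a..b}" "\<lambda>x. V x - h x"] ab by auto
  have pos: "V y > h y"
    using y(2)[OF x] neg by linarith
  then have "a < y" "y < b"
    using y(1) bdry by (auto simp: less_le)
  then have "hjb_rhs \<mu> \<sigma> q F y (V y) (h' y) \<le> h'' y"
    by (intro subsolution_local_test[OF V \<open>\<sigma> > 0\<close> _ h h' h'' ab(1)]) (use F h h' h'' y(2) in auto)
  then show False
    using hjb_rhs_strict_mono[OF \<open>\<sigma> > 0\<close> \<open>q > 0\<close> pos, of \<mu> F y "h' y"] eq[OF y(1)] by linarith
qed

lemma classical_le_supersolution:
  fixes V h h' h'' :: "real \<Rightarrow> real"
  assumes V: "viscosity_supersolution \<mu> \<sigma> q F V" "V \<in> linear_growth_space"
    and "\<sigma> > 0" "q > 0" and F: "\<And>x. x \<ge> 0 \<Longrightarrow> F x \<ge> 0"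
    and h: "\<And>x. (h has_real_derivative h' x) (at x)"
    and h': "\<And>x. (h' has_real_derivative h'' x) (at x)"
    and h'': "continuous_on UNIV h''" "\<And>x. \<bar>h'' x\<bar> \<le> B"
    and ab: "0 \<le> a" "a < b" and bdry: "h a = V a" "h b = V b"
    and eq: "\<And>x. x \<in> {a..b} \<Longrightarrow> h'' x = hjb_rhs \<mu> \<sigma> q F x (h x) (h' x)"
    and x: "x \<in> {a..b}"
  shows "h x \<le> V x"
proof (rule ccontr)
  assume neg: "\<not> h x \<le> V x"
  have "continuous_on {0..} V"
    using V(1) by (simp add: viscosity_supersolution_def)
  then have "continuous_on {a..b} V"
    using ab by (auto intro: continuous_on_subset)
  moreover have "continuous_on {a..b} h"
    using h by (meson DERIV_isCont continuous_at_imp_continuous_on)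
  ultimately have "continuous_on {a..b} (\<lambda>x. V x - h x)"
    by (rule continuous_on_diff)
  then obtain y where y: "y \<in> {a..b}" "\<And>x. x \<in> {a..b} \<Longrightarrow> V y - h y \<le> V x - h x"
    using continuous_attains_inf[of "{a..b}" "\<lambda>x. V x - h x"] ab by auto
  have pos: "V y < h y"
    using y(2)[OF x] neg by linarith
  then have "a < y" "y < b"
    using y(1) bdry by (auto simp: less_le)
  then have "h'' y \<le> hjb_rhs \<mu> \<sigma> q F y (V y) (h' y)"
    by (intro supersolution_local_test[OF V \<open>\<sigma> > 0\<close> _ h h' h'' ab(1)]) (use F h h' h'' y(2) in auto)
  then show False
    using hjb_rhs_strict_mono[OF \<open>\<sigma> > 0\<close> \<open>q > 0\<close> pos, of \<mu> F y "h' y"] eq[OF y(1)] by linarith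
qed

lemma hjb_rhs_lipschitz:
  assumes "\<sigma> > 0" "q > 0" "0 \<le> F x" "F x \<le> M"
  shows "\<bar>hjb_rhs \<mu> \<sigma> q F x u p - hjb_rhs \<mu> \<sigma> q F x v r\<bar>
           \<le> 2 / \<sigma>\<^sup>2 * (q + \<bar>\<mu>\<bar> + M) * (\<bar>u - v\<bar> + \<bar>p - r\<bar>)"
proof -
  define D where "D = q * (u - v) - \<mu> * (p - r) - F x * (max 0 (1 - p) - max 0 (1 - r))"
  have "\<bar>D\<bar> \<le> \<bar>q * (u - v)\<bar> + \<bar>\<mu> * (p - r)\<bar> + \<bar>F x * (max 0 (1 - p) - max 0 (1 - r))\<bar>"
    unfolding D_def by linarith
  also have "\<dots> = q * \<bar>u - v\<bar> + \<bar>\<mu>\<bar> * \<bar>p - r\<bar> + F x * \<bar>max 0 (1 - p) - max 0 (1 - r)\<bar>"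
    using assms by (simp add: abs_mult)
  also have "\<dots> \<le> q * \<bar>u - v\<bar> + \<bar>\<mu>\<bar> * \<bar>p - r\<bar> + M * \<bar>p - r\<bar>"
    using assms by (intro add_left_mono mult_mono) auto
  also have "\<dots> \<le> (q + \<bar>\<mu>\<bar> + M) * (\<bar>u - v\<bar> + \<bar>p - r\<bar>)"
    using assms by (simp add: algebra_simps)
  finally have "2 / \<sigma>\<^sup>2 * \<bar>D\<bar> \<le> 2 / \<sigma>\<^sup>2 * ((q + \<bar>\<mu>\<bar> + M) * (\<bar>u - v\<bar> + \<bar>p - r\<bar>))"
    by (intro mult_left_mono) auto
  moreover have "hjb_rhs \<mu> \<sigma> q F x u p - hjb_rhs \<mu> \<sigma> q F x v r = 2 / \<sigma>\<^sup>2 * D"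
    by (simp add: hjb_rhs_def D_def algebra_simps diff_divide_distrib)
  ultimately show ?thesis
    by (simp add: abs_mult mult.assoc[symmetric])
qed

text \<open>
  The admissible length depends on the Lipschitz constant alone, and this is uniform near \<open>x\<^sub>0\<close>
  because \<open>F\<close> is monotone. So one interval works for all boundary values, which allows
  it to be shared by the two functions that are compared.
\<close>
lemma short_interval_dirichlet_problem:
  assumes "\<sigma> > 0" "q > 0" and F: "\<And>x. x \<ge> 0 \<Longrightarrow> F x \<ge> 0"
    and mono: "mono_on {0..} F" and Fc: "continuous_on {0..} F" and x0: "x\<^sub>0 > 0"
  shows "\<exists>a b. 0 \<le> a \<and> a < x\<^sub>0 \<and> x\<^sub>0 < b \<and>
    (\<forall>\<alpha> \<beta>. \<exists>h h' h''. (\<forall>x. (h has_real_derivative h' x) (at x)) \<and>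
       (\<forall>x. (h' has_real_derivative h'' x) (at x)) \<and> continuous_on UNIV h'' \<and>
       (\<exists>B. \<forall>x. \<bar>h'' x\<bar> \<le> B) \<and> h a = \<alpha> \<and> h b = \<beta> \<and>
       (\<forall>x\<in>{a..b}. h'' x = hjb_rhs \<mu> \<sigma> q F x (h x) (h' x)))"
proof -
  define L where "L = 2 / \<sigma>\<^sup>2 * (q + \<bar>\<mu>\<bar> + F (x\<^sub>0 + 1))"
  have L: "L \<ge> 0"
    using assms(1,2) F[of "x\<^sub>0 + 1"] x0 by (simp add: L_def)
  \<comment> \<open>The three bounds keep the interval in the half-line, its length at most 1, and the
    contraction constant at most \<open>4 * L * \<delta> < 1\<close>.\<close>
  define \<delta> where "\<delta> = min (min x\<^sub>0 (1/2)) (1 / (8 * (L + 1)))"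
  have \<delta>: "0 < \<delta>" "\<delta> \<le> x\<^sub>0" "\<delta> \<le> 1/2" "\<delta> \<le> 1 / (8 * (L + 1))"
    using x0 L by (auto simp: \<delta>_def)
  define a where "a = x\<^sub>0 - \<delta>"
  define b where "b = x\<^sub>0 + \<delta>"
  have ab: "0 \<le> a" "a < x\<^sub>0" "x\<^sub>0 < b" "b \<le> x\<^sub>0 + 1" "b - a = 2 * \<delta>"
    using \<delta> by (auto simp: a_def b_def)
  have short: "L * ((b - a) * (b - a) + (b - a)) < 1"
  proof -
    have "2 * \<delta> * (2 * \<delta>) \<le> 2 * \<delta> * 1"
      using \<delta> by (intro mult_left_mono) auto
    then have "L * ((b - a) * (b - a) + (b - a)) \<le> L * (4 * \<delta>)"
      using ab L by (intro mult_left_mono) auto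
    also have "\<dots> \<le> L * (4 * (1 / (8 * (L + 1))))"
      using \<delta> L by (intro mult_left_mono) auto
    also have "\<dots> < 1"
      using L by (simp add: field_simps)
    finally show ?thesis .
  qed
  have lip: "\<bar>hjb_rhs \<mu> \<sigma> q F x u p - hjb_rhs \<mu> \<sigma> q F x v r\<bar> \<le> L * (\<bar>u - v\<bar> + \<bar>p - r\<bar>)"
    if "x \<in> {a..b}" for x u p v r
    unfolding L_def
    using that ab F[of x] assms(1,2) mono_onD[OF mono, of x "x\<^sub>0 + 1"]
    by (intro hjb_rhs_lipschitz) auto
  have "continuous_on {a..b} F"
    using Fc by (rule continuous_on_subset) (use ab in auto)
  then have cont: "continuous_on {a..b} (\<lambda>x. hjb_rhs \<mu> \<sigma> q F x (u x) (p x))"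
    if "continuous_on {a..b} u" "continuous_on {a..b} p" for u p
    unfolding hjb_rhs_def using that by (intro continuous_intros)
  have "a < b"
    using ab by simp
  note solvable = dirichlet_problem_solvable[where G = "hjb_rhs \<mu> \<sigma> q F",
      OF \<open>a < b\<close> L cont lip short]
  show ?thesis
    by (intro exI[of _ a] exI[of _ b] conjI allI solvable ab(1-3))
qed

section \<open>The penalised difference\<close>

text \<open>
  With \<open>A = (\<sigma>\<^sup>2 + F 1) / q\<close> and \<open>D = \<mu> / q\<close>, this says that \<open>\<psi> x = C + x\<^sup>2 - x\<close> satisfies
  \<open>q * \<psi> x \<ge> \<mu> * \<psi>' x + \<sigma>\<^sup>2 / 2 * \<psi>'' x + F 1\<close>. The constant comes from completing the square.
\<close>
lemma penalty_constant_exists: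
  fixes A D :: real
  shows "\<exists>C\<ge>1. \<forall>x. A + D * (2 * x - 1) \<le> C + x\<^sup>2 - x"
proof -
  define C where "C = 1 + \<bar>A - D\<bar> + (1/2 + D)\<^sup>2"
  have "A + D * (2 * x - 1) \<le> C + x\<^sup>2 - x" for x
  proof -
    have "0 \<le> (x - (1/2 + D))\<^sup>2"
      by simp
    also have "\<dots> = x\<^sup>2 - x - 2 * D * x + (1/2 + D)\<^sup>2"
      by (simp add: power2_eq_square algebra_simps)
    finally show ?thesis
      by (simp add: C_def algebra_simps)
  qed
  moreover have "C \<ge> 1"
    by (simp add: C_def)
  ultimately show ?thesis
    by blast
qed

text \<open>
  The quadratic penalty beats the linear growth of \<open>w\<close>, so the supremum is that over a compact
  interval containing \<open>z\<close>.
\<close>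
lemma penalised_max_exists:
  fixes w :: "real \<Rightarrow> real"
  assumes w: "continuous_on {0..} w" and gr: "\<And>x. x \<ge> 0 \<Longrightarrow> w x \<le> A * (1 + x)"
    and A: "A \<ge> 0" and "\<epsilon> > 0" "C \<ge> 1" and z: "z \<ge> 0" "w z - \<epsilon> * (C + z\<^sup>2 - z) > 0"
  shows "\<exists>x\<^sub>0\<ge>0. w x\<^sub>0 - \<epsilon> * (C + x\<^sub>0\<^sup>2 - x\<^sub>0) > 0 \<and>
           (\<forall>x\<ge>0. w x - \<epsilon> * (C + x\<^sup>2 - x) \<le> w x\<^sub>0 - \<epsilon> * (C + x\<^sub>0\<^sup>2 - x\<^sub>0))"
proof -
  define W where "W x = w x - \<epsilon> * (C + x\<^sup>2 - x)" for x
  define R where "R = max z (max 2 (4 * A / \<epsilon>))"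
  have far: "W x \<le> 0" if "x \<ge> R" for x
  proof -
    have x: "x \<ge> 2" "4 * A / \<epsilon> \<le> x"
      using that by (auto simp: R_def)
    have "A * (1 + x) \<le> A * (2 * x)"
      using x A by (intro mult_left_mono) auto
    also have "\<dots> = (4 * A) * (x / 2)"
      by simp
    also have "\<dots> \<le> (\<epsilon> * x) * (x / 2)"
      using x \<open>\<epsilon> > 0\<close> by (intro mult_right_mono) (auto simp: field_simps)
    also have "\<dots> = \<epsilon> * (x * x / 2)"
      by simp
    also have "\<dots> \<le> \<epsilon> * (C + x\<^sup>2 - x)"
    proof (intro mult_left_mono)
      have "2 * x \<le> x * x"
        using x by (intro mult_right_mono) auto
      then show "x * x / 2 \<le> C + x\<^sup>2 - x"
        using \<open>C \<ge> 1\<close> by (simp add: power2_eq_square)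
    qed (use \<open>\<epsilon> > 0\<close> in simp)
    finally show ?thesis
      using gr[of x] x by (simp add: W_def)
  qed
  have "continuous_on {0..R} W"
    unfolding W_def by (intro continuous_intros continuous_on_subset[OF w]) auto
  moreover have "z \<in> {0..R}"
    using z by (auto simp: R_def)
  ultimately obtain x0 where x0: "x0 \<in> {0..R}" "\<And>x. x \<in> {0..R} \<Longrightarrow> W x \<le> W x0"
    using continuous_attains_sup[of "{0..R}" W] by auto
  have pos: "W x0 > 0"
    using x0(2)[OF \<open>z \<in> {0..R}\<close>] z by (simp add: W_def)
  have "W x \<le> W x0" if "x \<ge> 0" for x
    using far[of x] x0(2)[of x] pos that by (cases "x \<le> R") auto
  then show ?thesis
    using x0(1) pos by (auto simp: W_def)
qed

text \<open>
  Passing from \<open>V\<^sub>2 - V\<^sub>1\<close> to \<open>h2 - h1\<close>, with classical solutions taking the same boundary values on a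
  short interval around \<open>x\<^sub>0\<close>, preserves the end values of the penalised difference and does not lower
  its value at \<open>x\<^sub>0\<close>. The smooth penalised difference thus again has a positive interior maximum.
  There its derivative vanishes and its second derivative is at most \<open>0\<close>. Subtracting the two
  equations then bounds \<open>q * (h2 - h1)\<close> by the expression that \<open>C\<close> was chosen to dominate, so that
  \<open>h2 - h1\<close> is at most the penalty and the maximum cannot be positive.
\<close>
lemma no_interior_penalised_max:
  fixes V\<^sub>1 V\<^sub>2 F :: "real \<Rightarrow> real"
  assumes "\<sigma> > 0" "q > 0" and F: "\<And>x. x \<ge> 0 \<Longrightarrow> F x \<ge> 0"
    and mono: "mono_on {0..} F" and Fc: "continuous_on {0..} F"
    and V1: "viscosity_supersolution \<mu> \<sigma> q F V\<^sub>1" "V\<^sub>1 \<in> linear_growth_space"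
    and V2: "viscosity_subsolution \<mu> \<sigma> q F V\<^sub>2" "V\<^sub>2 \<in> linear_growth_space"
    and "\<epsilon> > 0"
    and C: "\<And>x. (\<sigma>\<^sup>2 + F 1) / q + \<mu> / q * (2 * x - 1) \<le> C + x\<^sup>2 - x"
    and x0: "x\<^sub>0 > 0"
    and pos: "V\<^sub>2 x\<^sub>0 - V\<^sub>1 x\<^sub>0 - \<epsilon> * (C + x\<^sub>0\<^sup>2 - x\<^sub>0) > 0"
    and max: "\<And>x. x \<ge> 0 \<Longrightarrow> V\<^sub>2 x - V\<^sub>1 x - \<epsilon> * (C + x\<^sup>2 - x) \<le>
                V\<^sub>2 x\<^sub>0 - V\<^sub>1 x\<^sub>0 - \<epsilon> * (C + x\<^sub>0\<^sup>2 - x\<^sub>0)"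
  shows False
proof -
  obtain a b where ab: "0 \<le> a" "a < x\<^sub>0" "x\<^sub>0 < b"
    and solve: "\<And>\<alpha> \<beta>. \<exists>h h' h''. (\<forall>x. (h has_real_derivative h' x) (at x)) \<and>
       (\<forall>x. (h' has_real_derivative h'' x) (at x)) \<and> continuous_on UNIV h'' \<and>
       (\<exists>B. \<forall>x. \<bar>h'' x\<bar> \<le> B) \<and> h a = \<alpha> \<and> h b = \<beta> \<and>
       (\<forall>x\<in>{a..b}. h'' x = hjb_rhs \<mu> \<sigma> q F x (h x) (h' x))"
    using short_interval_dirichlet_problem[OF assms(1,2) F mono Fc x0, of \<mu>] by blast
  obtain h1 h1' h1'' B1 where h1: "\<And>x. (h1 has_real_derivative h1' x) (at x)"
      "\<And>x. (h1' has_real_derivative h1'' x) (at x)" "continuous_on UNIV h1''"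
      "\<And>x. \<bar>h1'' x\<bar> \<le> B1" and h1_bdry: "h1 a = V\<^sub>1 a" "h1 b = V\<^sub>1 b"
    and h1_eq: "\<And>x. x \<in> {a..b} \<Longrightarrow> h1'' x = hjb_rhs \<mu> \<sigma> q F x (h1 x) (h1' x)"
    using solve[of "V\<^sub>1 a" "V\<^sub>1 b"] by metis
  obtain h2 h2' h2'' B2 where h2: "\<And>x. (h2 has_real_derivative h2' x) (at x)"
      "\<And>x. (h2' has_real_derivative h2'' x) (at x)" "continuous_on UNIV h2''"
      "\<And>x. \<bar>h2'' x\<bar> \<le> B2" and h2_bdry: "h2 a = V\<^sub>2 a" "h2 b = V\<^sub>2 b"
    and h2_eq: "\<And>x. x \<in> {a..b} \<Longrightarrow> h2'' x = hjb_rhs \<mu> \<sigma> q F x (h2 x) (h2' x)"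
    using solve[of "V\<^sub>2 a" "V\<^sub>2 b"] by metis
  have "a < b"
    using ab by simp
  have le1: "h1 x\<^sub>0 \<le> V\<^sub>1 x\<^sub>0"
    by (rule classical_le_supersolution[of \<mu> \<sigma> q F V\<^sub>1 h1 h1' h1'' B1 a b])
      (use V1 assms(1,2) F h1 ab h1_bdry h1_eq in auto)
  have le2: "V\<^sub>2 x\<^sub>0 \<le> h2 x\<^sub>0"
    by (rule subsolution_le_classical[of \<mu> \<sigma> q F V\<^sub>2 h2 h2' h2'' B2 a b])
      (use V2 assms(1,2) F h2 ab h2_bdry h2_eq in auto)
  define g where "g x = h2 x - h1 x - \<epsilon> * (C + x\<^sup>2 - x)" for x
  define g' where "g' x = h2' x - h1' x - \<epsilon> * (2 * x - 1)" for x
  have g: "(g has_real_derivative g' x) (at x)" for x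
    unfolding g_def g'_def by (auto intro!: derivative_eq_intros h1 h2)
  have g': "(g' has_real_derivative h2'' x - h1'' x - \<epsilon> * 2) (at x)" for x
    unfolding g'_def by (auto intro!: derivative_eq_intros h1 h2)
  have x0_pos: "g x\<^sub>0 > 0"
    using pos le1 le2 by (simp add: g_def)
  have ends: "g a \<le> g x\<^sub>0" "g b \<le> g x\<^sub>0"
    using max[of a] max[of b] le1 le2 ab by (auto simp: g_def h1_bdry h2_bdry)
  have "continuous_on {a..b} g"
    using g by (meson DERIV_isCont continuous_at_imp_continuous_on)
  then obtain y0 where y0: "y0 \<in> {a..b}" "\<And>x. x \<in> {a..b} \<Longrightarrow> g x \<le> g y0"
    using continuous_attains_sup[of "{a..b}" g] ab by auto
  \<comment> \<open>If the maximum is attained at an end of the interval, then \<open>ends\<close> shows that it is attained at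
    \<open>x\<^sub>0\<close> too.\<close>
  define y where "y = (if y0 = a \<or> y0 = b then x\<^sub>0 else y0)"
  have y: "a < y" "y < b"
    using y0(1) ab by (auto simp: y_def)
  have y_max: "g x \<le> g y" if "a \<le> x" "x \<le> b" for x
    using y0(2)[of x] ends that by (auto simp: y_def)
  have "y \<ge> 0"
    using ab y by simp
  have y_pos: "g y > 0"
    using y_max[of x\<^sub>0] x0_pos ab by simp
  have "g' y = 0" and g''_y: "h2'' y - h1'' y - \<epsilon> * 2 \<le> 0"
    using second_derivative_nonpos_at_max[OF y y_max g g'] by blast+
  then have slope: "h2' y = h1' y + \<epsilon> * (2 * y - 1)"
    by (simp add: g'_def)
  \<comment> \<open>The two slopes differ by \<open>\<epsilon> * (2 * y - 1)\<close>. For \<open>y \<ge> 1/2\<close> the control term of \<open>h2\<close> is therefore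
    at most that of \<open>h1\<close>, whatever the size of \<open>F y\<close>.\<close>
  have drift: "F y * (max 0 (1 - h2' y) - max 0 (1 - h1' y)) \<le> \<epsilon> * F 1"
  proof -
    have "max 0 (1 - h2' y) - max 0 (1 - h1' y) \<le> max 0 (\<epsilon> * (1 - 2 * y))"
      by (simp add: slope algebra_simps max_def)
    also have "\<dots> = \<epsilon> * max 0 (1 - 2 * y)"
      using \<open>\<epsilon> > 0\<close> by (simp add: max_def mult_le_0_iff zero_le_mult_iff)
    finally have "F y * (max 0 (1 - h2' y) - max 0 (1 - h1' y)) \<le> F y * (\<epsilon> * max 0 (1 - 2 * y))"
      using F \<open>y \<ge> 0\<close> by (intro mult_left_mono) auto
    also have "\<dots> = \<epsilon> * (F y * max 0 (1 - 2 * y))"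
      by simp
    also have "F y * max 0 (1 - 2 * y) \<le> F 1"
    proof (cases "y \<le> 1/2")
      case True
      then have "F y * max 0 (1 - 2 * y) \<le> F y * 1"
        using F \<open>y \<ge> 0\<close> by (intro mult_left_mono) auto
      also have "\<dots> \<le> F 1"
        using mono_onD[OF mono, of y 1] True \<open>y \<ge> 0\<close> by simp
      finally show ?thesis .
    qed (use F[of 1] in simp)
    finally show ?thesis
      using \<open>\<epsilon> > 0\<close> by simp
  qed
  have "h2'' y - h1'' y = 2 / \<sigma>\<^sup>2 * (q * (h2 y - h1 y) - \<mu> * (\<epsilon> * (2 * y - 1))
      - F y * (max 0 (1 - h2' y) - max 0 (1 - h1' y)))"
  proof -
    have *: "h2'' y = hjb_rhs \<mu> \<sigma> q F y (h2 y) (h2' y)" "h1'' y = hjb_rhs \<mu> \<sigma> q F y (h1 y) (h1' y)"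
      using h1_eq h2_eq y by auto
    have "\<epsilon> * (2 * y - 1) = h2' y - h1' y"
      using slope by simp
    then show ?thesis
      unfolding * hjb_rhs_def by (simp only:) (simp add: algebra_simps diff_divide_distrib)
  qed
  then have "2 / \<sigma>\<^sup>2 * (q * (h2 y - h1 y) - \<mu> * (\<epsilon> * (2 * y - 1))
      - F y * (max 0 (1 - h2' y) - max 0 (1 - h1' y))) \<le> \<epsilon> * 2"
    using g''_y by simp
  then have "q * (h2 y - h1 y) - \<mu> * (\<epsilon> * (2 * y - 1))
      - F y * (max 0 (1 - h2' y) - max 0 (1 - h1' y)) \<le> \<epsilon> * \<sigma>\<^sup>2"
    using \<open>\<sigma> > 0\<close> by (simp add: field_simps)
  then have "q * (h2 y - h1 y) \<le> \<epsilon> * (\<sigma>\<^sup>2 + F 1 + \<mu> * (2 * y - 1))"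
    using drift by (simp add: algebra_simps)
  also have "\<dots> \<le> \<epsilon> * (q * (C + y\<^sup>2 - y))"
  proof (rule mult_left_mono)
    have "q * ((\<sigma>\<^sup>2 + F 1) / q + \<mu> / q * (2 * y - 1)) \<le> q * (C + y\<^sup>2 - y)"
      using C[of y] \<open>q > 0\<close> by (intro mult_left_mono) auto
    moreover have "q * ((\<sigma>\<^sup>2 + F 1) / q + \<mu> / q * (2 * y - 1)) = \<sigma>\<^sup>2 + F 1 + \<mu> * (2 * y - 1)"
      using \<open>q > 0\<close> by (simp add: field_simps)
    ultimately show "\<sigma>\<^sup>2 + F 1 + \<mu> * (2 * y - 1) \<le> q * (C + y\<^sup>2 - y)"
      by simp
  qed (use \<open>\<epsilon> > 0\<close> in simp)
  finally have "q * (h2 y - h1 y) \<le> q * (\<epsilon> * (C + y\<^sup>2 - y))"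
    by (simp add: algebra_simps)
  then show False
    using y_pos \<open>q > 0\<close> by (simp add: g_def)
qed

theorem theorem10:
  fixes \<mu> \<sigma> q :: real and F V\<^sub>1 V\<^sub>2 :: "real \<Rightarrow> real"
  assumes "\<sigma> > 0" and "q > 0"
    and "\<And>x. x \<ge> 0 \<Longrightarrow> F x \<ge> 0"
    and "mono_on {0..} F"
    and "concave_on {0..} F"
    and "C1_halfline F"
    and "V\<^sub>1 \<in> linear_growth_space" and "V\<^sub>2 \<in> linear_growth_space"
    and "viscosity_supersolution \<mu> \<sigma> q F V\<^sub>1"
    and "viscosity_subsolution \<mu> \<sigma> q F V\<^sub>2"
    and "V\<^sub>1 0 \<ge> V\<^sub>2 0 \<or>
         (\<exists>d\<^sub>1 d\<^sub>2. (V\<^sub>1 has_real_derivative d\<^sub>1) (at_right 0) \<and>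
                  (V\<^sub>2 has_real_derivative d\<^sub>2) (at_right 0) \<and> d\<^sub>1 \<le> d\<^sub>2)"
  shows "\<forall>x\<ge>0. V\<^sub>1 x \<ge> V\<^sub>2 x"
proof (rule ccontr)
  assume "\<not> (\<forall>x\<ge>0. V\<^sub>1 x \<ge> V\<^sub>2 x)"
  then obtain z where z: "z \<ge> 0" "V\<^sub>2 z - V\<^sub>1 z > 0"
    by (auto simp: not_le)
  obtain C where C: "C \<ge> 1" "\<And>x. (\<sigma>\<^sup>2 + F 1) / q + \<mu> / q * (2 * x - 1) \<le> C + x\<^sup>2 - x"
    using penalty_constant_exists by blast
  define P where "P = C + z\<^sup>2 - z"
  have "0 \<le> (z - 1/2)\<^sup>2"
    by simp
  then have "P > 0"
    using C(1) by (simp add: P_def power2_eq_square algebra_simps)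
  \<comment> \<open>Small enough for the penalty to take away only half of the excess at \<open>z\<close>.\<close>
  define \<epsilon> where "\<epsilon> = (V\<^sub>2 z - V\<^sub>1 z) / (2 * P)"
  have \<epsilon>: "\<epsilon> > 0"
    using z \<open>P > 0\<close> by (simp add: \<epsilon>_def)
  have "\<epsilon> * P = (V\<^sub>2 z - V\<^sub>1 z) / 2"
    using \<open>P > 0\<close> by (simp add: \<epsilon>_def)
  then have z_pos: "V\<^sub>2 z - V\<^sub>1 z - \<epsilon> * (C + z\<^sup>2 - z) > 0"
    using z unfolding P_def by simp
  obtain A1 where A1: "A1 \<ge> 0" "\<And>x. x \<ge> 0 \<Longrightarrow> \<bar>V\<^sub>1 x\<bar> \<le> A1 * (1 + x)"
    using linear_growth_bound assms(7) by blast
  obtain A2 where A2: "A2 \<ge> 0" "\<And>x. x \<ge> 0 \<Longrightarrow> \<bar>V\<^sub>2 x\<bar> \<le> A2 * (1 + x)"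
    using linear_growth_bound assms(8) by blast
  have growth: "V\<^sub>2 x - V\<^sub>1 x \<le> (A1 + A2) * (1 + x)" if "x \<ge> 0" for x
    using A1(2)[OF that] A2(2)[OF that] unfolding distrib_right by linarith
  have cont: "continuous_on {0..} (\<lambda>x. V\<^sub>2 x - V\<^sub>1 x)"
    using assms(7,8) by (auto simp: linear_growth_space_def intro!: continuous_intros)
  obtain x0 where x0: "x0 \<ge> 0" "V\<^sub>2 x0 - V\<^sub>1 x0 - \<epsilon> * (C + x0\<^sup>2 - x0) > 0"
    and max: "\<And>x. x \<ge> 0 \<Longrightarrow> V\<^sub>2 x - V\<^sub>1 x - \<epsilon> * (C + x\<^sup>2 - x) \<le>
                V\<^sub>2 x0 - V\<^sub>1 x0 - \<epsilon> * (C + x0\<^sup>2 - x0)"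
    using penalised_max_exists[OF cont growth _ \<epsilon> C(1) z(1) z_pos] A1(1) A2(1)
    by (metis add_nonneg_nonneg)
  have "x0 \<noteq> 0"
    using assms(11)
  proof
    assume "V\<^sub>1 0 \<ge> V\<^sub>2 0"
    moreover have "\<epsilon> * C > 0"
      using \<epsilon> C(1) by simp
    ultimately show ?thesis
      using x0(2) by auto
  next
    assume "\<exists>d\<^sub>1 d\<^sub>2. (V\<^sub>1 has_real_derivative d\<^sub>1) (at_right 0) \<and>
                  (V\<^sub>2 has_real_derivative d\<^sub>2) (at_right 0) \<and> d\<^sub>1 \<le> d\<^sub>2"
    then obtain d1 d2 where d: "(V\<^sub>1 has_real_derivative d1) (at_right 0)"
        "(V\<^sub>2 has_real_derivative d2) (at_right 0)" "d1 \<le> d2"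
      by blast
    \<comment> \<open>The linear term of the penalty contributes \<open>\<epsilon> > 0\<close>, which makes the derivative strictly positive
      even when \<open>d1 = d2\<close>.\<close>
    have "((\<lambda>x. V\<^sub>2 x - V\<^sub>1 x - \<epsilon> * (C + x\<^sup>2 - x)) has_real_derivative d2 - d1 + \<epsilon>) (at_right 0)"
      by (auto intro!: derivative_eq_intros d)
    from has_real_derivative_pos_inc_right[OF this] d(3) \<epsilon>
    obtain e where e: "e > 0" "\<And>h. h > 0 \<Longrightarrow> h < e \<Longrightarrow>
        V\<^sub>2 0 - V\<^sub>1 0 - \<epsilon> * (C + 0\<^sup>2 - 0) < V\<^sub>2 h - V\<^sub>1 h - \<epsilon> * (C + h\<^sup>2 - h)"
      by auto
    show ?thesis
      using e(2)[of "e / 2"] e(1) max[of "e / 2"] by auto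
  qed
  then have "x0 > 0"
    using x0(1) by simp
  have Fc: "continuous_on {0..} F"
    using assms(6) unfolding C1_halfline_def by (auto intro: DERIV_continuous_on)
  show False
    by (rule no_interior_penalised_max[of \<sigma> q F \<mu> V\<^sub>1 V\<^sub>2 \<epsilon> C x0,
          OF assms(1-4) Fc assms(9,7,10,8) \<epsilon> C(2) \<open>x0 > 0\<close> x0(2) max])
qed

end
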